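(* Let $\star$ be a semistar operation on an integral domain $D$, let $D$ be a P$\star$MD and let $P\in\mathrm{QSpec}^{\star_f}(D)$. Then the following statements are equivalent. (i) $P$ is $\star_f$-sharp. (ii) $\widetilde{\mathtt{s}_{\Delta^{\star_f}(P)}}\lneq\widetilde{\mathtt{s}_{\nabla^{\star_f}(P)}}$. (iii) $(\mathtt{s}_{\Delta^{\star_f}(P)})_f\lneq(\mathtt{s}_{\nabla^{\star_f}(P)})_f$. (iv) $(\mathtt{s}_{\Delta^{\star_f}(P)})_a\lneq(\mathtt{s}_{\nabla^{\star_f}(P)})_a$.
   Context: Let $D$ be an integral domain with quotient field $K$. Denote by $\overline{\boldsymbol F}(D)$ the set of nonzero $D$-submodules of $K$ and by $\boldsymbol f(D)$ the set of nonzero finitely generated $D$-submodules of $K$. A semistar operation on $D$ is a map $\star:\overline{\boldsymbol F}(D)\to\overline{\boldsymbol F}(D)$, $E\mapsto E^\star$, such that for all $0\ne x\in K$ and $E,F\in\overline{\boldsymbol F}(D)$: $(xE)^\star=xE^\star$; $E\subseteq F$ implies $E^\star\subseteq F^\star$; $E\subseteq E^\star$ and $(E^\star)^\star=E^\star$. Write $\star_1\le\star_2$ if $E^{\star_1}\subseteq E^{\star_2}$ for all $E\in\overline{\boldsymbol F}(D)$, and $\star_1\lneq\star_2$ if moreover $\star_1\neq\star_2$. The associated finite-type operation is $E^{\star_f}:=\bigcup\{F^\star\mid F\in\boldsymbol f(D),\,F\subseteq E\}$. The operation $\star_a$ is given by $F^{\star_a}:=\bigcup\{((FH)^\star:H^\star)\mid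 H\in\boldsymbol f(D)\}$ for $F\in\boldsymbol f(D)$ and $E^{\star_a}:=\bigcup\{F^{\star_a}\mid F\subseteq E,\ F\in\boldsymbol f(D)\}$ for $E\in\overline{\boldsymbol F}(D)$ (colons taken in $K$). P$\star$MD: $D$ is a P$\star$MD if $(FF^{-1})^{\star_f}=D^{\star}$ for every $F\in\boldsymbol f(D)$, where $F^{-1}=(D:_KF)$. A nonzero ideal $I$ of $D$ is a quasi-$\star$-ideal if $I^\star\cap D=I$. $\mathrm{QSpec}^{\star}(D)$ is the set of prime quasi-$\star$-ideals, and $\mathrm{QMax}^{\star}(D)$ the set of ideals maximal among the proper quasi-$\star$-ideals. For $Y\subseteq\mathrm{Spec}(D)$, $\mathtt{s}_Y$ is the semistar operation $E^{\mathtt{s}_Y}:=\bigcap\{ED_Q\mid Q\in Y\}$, with $E^{\mathtt{s}_\emptyset}:=K$. For a semistar operation $\star$, $\widetilde\star:=\mathtt{s}_{\mathrm{QMax}^{\star_f}(D)}$. For $P\in\mathrm{QSpec}^{\star_f}(D)$: $\nabla^{\star_f}(P):=\{M\in\mathrm{QMax}^{\star_f}(D)\mid M\nsupseteq P\}$, $\Delta^{\star_f}(P):=\nabla^{\star_f}(P)\cup\{P\}$, $\Theta^{\star_f}(P):=\bigcap\{D_M\mid M\in\nabla^{\star_f}(P)\}$ (an empty intersection is $K$). $P$ is $\star_f$-sharp if $\Theta^{\star_f}(P)\nsubseteq D_P$. *)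

theory Defs
  imports "HOL-Computational_Algebra.Polynomial_Factorial"
begin

text \<open>
  The integral domain \<open>D\<close> is a type \<open>'d :: idom\<close> and its quotient field \<open>K\<close> is \<open>'d fract\<close>, into
  which \<open>D\<close> embeds by \<^const>\<open>to_fract\<close>. Submodules of \<open>K\<close> are sets in \<open>'d fract\<close>; ideals of \<open>D\<close> are
  sets in \<open>'d\<close>.
\<close>

definition dscale :: "'d::idom \<Rightarrow> 'd fract \<Rightarrow> 'd fract" where
  "dscale d x = to_fract d * x"

lemma module_dscale: "module (dscale :: 'd::idom \<Rightarrow> 'd fract \<Rightarrow> 'd fract)"
  by unfold_locales (simp_all add: dscale_def algebra_simps)

definition base_ring :: "'d::idom fract set" where
  "base_ring = range to_fract"

definition submods :: "'d::idom fract set set" where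
  "submods = {E. module.subspace dscale E \<and> E \<noteq> {0}}"

definition fg_submods :: "'d::idom fract set set" where
  "fg_submods = {F \<in> submods. \<exists>A. finite A \<and> F = module.span dscale A}"

definition mod_prod :: "'d::idom fract set \<Rightarrow> 'd fract set \<Rightarrow> 'd fract set" where
  "mod_prod E F = module.span dscale {x * y | x y. x \<in> E \<and> y \<in> F}"

definition colon :: "'d::idom fract set \<Rightarrow> 'd fract set \<Rightarrow> 'd fract set" where
  "colon E F = {x. \<forall>y\<in>F. x * y \<in> E}"

definition mod_inv :: "'d::idom fract set \<Rightarrow> 'd fract set" where
  "mod_inv F = colon base_ring F"


text \<open>
  An operation is a total function on sets, but only its values on \<^const>\<open>submods\<close> are
  meaningful, so operations are compared on \<^const>\<open>submods\<close> only.
\<close>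

type_synonym 'd operation = "'d fract set \<Rightarrow> 'd fract set"

definition semistar :: "'d::idom operation \<Rightarrow> bool" where
  "semistar star \<longleftrightarrow>
     (\<forall>E\<in>submods. star E \<in> submods) \<and>
     (\<forall>x. \<forall>E\<in>submods. x \<noteq> 0 \<longrightarrow> star ((*) x ` E) = (*) x ` star E) \<and>
     (\<forall>E\<in>submods. \<forall>F\<in>submods. E \<subseteq> F \<longrightarrow> star E \<subseteq> star F) \<and>
     (\<forall>E\<in>submods. E \<subseteq> star E \<and> star (star E) = star E)"

definition op_le :: "'d::idom operation \<Rightarrow> 'd operation \<Rightarrow> bool" where
  "op_le star1 star2 \<longleftrightarrow> (\<forall>E\<in>submods. star1 E \<subseteq> star2 E)"

definition op_less :: "'d::idom operation \<Rightarrow> 'd operation \<Rightarrow> bool" where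
  "op_less star1 star2 \<longleftrightarrow> op_le star1 star2 \<and> (\<exists>E\<in>submods. star1 E \<noteq> star2 E)"

definition star_f :: "'d::idom operation \<Rightarrow> 'd operation" where
  "star_f star E = \<Union>{star F | F. F \<in> fg_submods \<and> F \<subseteq> E}"

definition star_a_fg :: "'d::idom operation \<Rightarrow> 'd operation" where
  "star_a_fg star F = \<Union>{colon (star (mod_prod F H)) (star H) | H. H \<in> fg_submods}"

text \<open>
  The union formula is used for all \<open>E\<close>; on finitely generated modules it agrees with
  \<^const>\<open>star_a_fg\<close> by the lemma \<open>star_a_eq_star_a_fg\<close> below.
\<close>

definition star_a :: "'d::idom operation \<Rightarrow> 'd operation" where
  "star_a star E = \<Union>{star_a_fg star F | F. F \<in> fg_submods \<and> F \<subseteq> E}"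

lemma mod_prod_submods:
  assumes "E \<in> submods" "F \<in> submods"
  shows "mod_prod E F \<in> submods"
proof -
  interpret module dscale by (rule module_dscale)
  have "\<exists>x\<in>G. x \<noteq> 0" if "G \<in> submods" for G :: "'a fract set"
    using that subspace_0[of G] unfolding submods_def by blast
  with assms obtain x y where xy: "x \<in> E" "x \<noteq> 0" "y \<in> F" "y \<noteq> 0"
    by metis
  then have "x * y \<in> mod_prod E F"
    unfolding mod_prod_def by (intro span_base) blast
  moreover have "x * y \<noteq> 0"
    using xy by simp
  ultimately have "mod_prod E F \<noteq> {0}"
    by blast
  moreover have "subspace (mod_prod E F)"
    unfolding mod_prod_def by (rule subspace_span)
  ultimately show ?thesis
    unfolding submods_def by blast
qed

lemma mod_prod_mono: "E \<subseteq> E' \<Longrightarrow> mod_prod E F \<subseteq> mod_prod E' F"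
  unfolding mod_prod_def by (rule module.span_mono[OF module_dscale]) blast

lemma star_a_eq_star_a_fg:
  assumes "semistar star" "F \<in> fg_submods"
  shows "star_a star F = star_a_fg star F"
proof -
  have "star_a_fg star F' \<subseteq> star_a_fg star F" if F': "F' \<in> fg_submods" "F' \<subseteq> F" for F'
  proof -
    have "colon (star (mod_prod F' H)) (star H) \<subseteq> colon (star (mod_prod F H)) (star H)"
      if "H \<in> fg_submods" for H
    proof -
      have "star (mod_prod F' H) \<subseteq> star (mod_prod F H)"
        using assms F' that mod_prod_submods[of _ H] mod_prod_mono[OF F'(2), of H]
        by (auto simp: semistar_def fg_submods_def)
      then show ?thesis by (auto simp: colon_def)
    qed
    then show ?thesis unfolding star_a_fg_def by blast
  qed
  with assms(2) show ?thesis unfolding star_a_def by blast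
qed

definition PstarMD :: "'d::idom operation \<Rightarrow> bool" where
  "PstarMD star \<longleftrightarrow>
     (\<forall>F\<in>fg_submods. star_f star (mod_prod F (mod_inv F)) = star base_ring)"


definition dideal :: "'d::idom set \<Rightarrow> bool" where
  "dideal I \<longleftrightarrow> module.subspace (*) I"

definition Spec :: "'d::idom set set" where
  "Spec = {P. dideal P \<and> P \<noteq> UNIV \<and> (\<forall>a b. a * b \<in> P \<longrightarrow> a \<in> P \<or> b \<in> P)}"

definition quasi_ideal :: "'d::idom operation \<Rightarrow> 'd set \<Rightarrow> bool" where
  "quasi_ideal star I \<longleftrightarrow>
     dideal I \<and> I \<noteq> {0} \<and> star (to_fract ` I) \<inter> base_ring = to_fract ` I"

definition QSpec :: "'d::idom operation \<Rightarrow> 'd set set" where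
  "QSpec star = {P \<in> Spec. quasi_ideal star P}"

definition QMax :: "'d::idom operation \<Rightarrow> 'd set set" where
  "QMax star = {M. quasi_ideal star M \<and> M \<noteq> UNIV \<and>
     (\<forall>J. quasi_ideal star J \<and> J \<noteq> UNIV \<and> M \<subseteq> J \<longrightarrow> J = M)}"

definition localization :: "'d::idom set \<Rightarrow> 'd fract set" where
  "localization Q = {to_fract a / to_fract s | a s. s \<notin> Q}"

text \<open>For \<open>Y = {}\<close> the intersection is \<^const>\<open>UNIV\<close>, that is \<open>K\<close>; likewise in \<open>Theta\<close> below.\<close>

definition spectral :: "'d::idom set set \<Rightarrow> 'd operation" where
  "spectral Y E = (\<Inter>Q\<in>Y. mod_prod E (localization Q))"

definition star_tilde :: "'d::idom operation \<Rightarrow> 'd operation" where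
  "star_tilde star = spectral (QMax (star_f star))"

definition nabla :: "'d::idom operation \<Rightarrow> 'd set \<Rightarrow> 'd set set" where
  "nabla star P = {M \<in> QMax star. \<not> P \<subseteq> M}"

definition Delta :: "'d::idom operation \<Rightarrow> 'd set \<Rightarrow> 'd set set" where
  "Delta star P = nabla star P \<union> {P}"

definition Theta :: "'d::idom operation \<Rightarrow> 'd set \<Rightarrow> 'd fract set" where
  "Theta star P = (\<Inter>M\<in>nabla star P. localization M)"

definition sharp :: "'d::idom operation \<Rightarrow> 'd set \<Rightarrow> bool" where
  "sharp star P \<longleftrightarrow> \<not> Theta star P \<subseteq> localization P"

end

theory Submission
  imports Defs
begin

text \<open>
  For a prime \<open>Q\<close>, an element \<open>x\<close> lies in \<open>E D\<^sub>Q\<close> iff \<open>s x \<in> E\<close> for some \<open>s \<notin> Q\<close>; all closures under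
  spectral operations are computed in this form. In a P\<open>\<star>\<close>MD a finitely generated \<open>F\<close> is invertible
  at every quasi-\<open>\<star>\<^sub>f\<close>-prime \<open>P\<close>, that is \<open>F F\<^sup>-\<^sup>1\<close> is not contained in \<open>P\<close>. If \<open>P\<close> is not sharp and \<open>y\<close> is in
  the \<open>\<nabla>\<close>-closure of \<open>F\<close>, then \<open>y F\<^sup>-\<^sup>1\<close> lies in \<open>\<Theta>(P)\<close>, hence in \<open>D\<^sub>P\<close>, and invertibility gives \<open>y \<in> F D\<^sub>P\<close>:
  the two spectral operations agree on finitely generated modules, and so do all operations derived
  from them. If \<open>P\<close> is sharp, any \<open>x\<close> in \<open>\<Theta>(P)\<close> outside \<open>D\<^sub>P\<close> lies in the closure of \<open>D\<close> under each operation
  derived from \<open>\<nabla>\<close>, but under none derived from \<open>\<Delta>\<close>.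
\<close>

interpretation dscale: module "dscale :: 'd::idom \<Rightarrow> 'd fract \<Rightarrow> 'd fract"
  by (rule module_dscale)

section \<open>Submodules of the quotient field\<close>

lemma subspace_dscale_iff:
  "dscale.subspace E \<longleftrightarrow>
     0 \<in> E \<and> (\<forall>x\<in>E. \<forall>y\<in>E. x + y \<in> E) \<and> (\<forall>c. \<forall>x\<in>E. to_fract c * x \<in> E)"
  by (simp add: dscale.subspace_def dscale_def)

lemma dideal_iff:
  "dideal I \<longleftrightarrow> 0 \<in> I \<and> (\<forall>x\<in>I. \<forall>y\<in>I. x + y \<in> I) \<and> (\<forall>c. \<forall>x\<in>I. c * x \<in> I)"
proof -
  have "module ((*) :: 'a \<Rightarrow> 'a \<Rightarrow> 'a)"
    by unfold_locales (simp_all add: algebra_simps)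
  then show ?thesis by (simp add: dideal_def module.subspace_def)
qed

lemma submods_subspace: "E \<in> submods \<Longrightarrow> dscale.subspace E"
  by (simp add: submods_def)

lemma submodsI: "dscale.subspace E \<Longrightarrow> x \<in> E \<Longrightarrow> x \<noteq> 0 \<Longrightarrow> E \<in> submods"
  by (auto simp: submods_def)

lemma submods_nonzero:
  assumes "E \<in> submods"
  obtains x where "x \<in> E" "x \<noteq> 0"
  using assms dscale.subspace_0[of E] unfolding submods_def by blast

lemma to_fract_mult_closed: "E \<in> submods \<Longrightarrow> x \<in> E \<Longrightarrow> to_fract c * x \<in> E"
  by (simp add: submods_def subspace_dscale_iff)

lemma fract_denominator:
  fixes x :: "'d::idom fract"
  obtains a s where "s \<noteq> 0" "to_fract s * x = to_fract a"
proof (cases x rule: Fract_cases)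
  case (Fract a b)
  then have "to_fract b * x = to_fract a"
    by (simp add: to_fract_def eq_fract mult.commute)
  with Fract(2) show thesis by (rule that)
qed

lemma subspace_base_ring: "dscale.subspace (base_ring :: 'd::idom fract set)"
  unfolding subspace_dscale_iff base_ring_def
  by (auto simp flip: to_fract_0 to_fract_add to_fract_mult)

lemma one_in_base_ring: "1 \<in> base_ring"
  unfolding base_ring_def by (metis rangeI to_fract_1)

lemma base_ring_fg: "base_ring \<in> (fg_submods :: 'd::idom fract set set)"
proof -
  have "base_ring = dscale.span {1 :: 'd fract}"
    unfolding dscale.span_singleton base_ring_def by (simp add: dscale_def)
  moreover have "base_ring \<in> (submods :: 'd fract set set)"
    using subspace_base_ring one_in_base_ring by (rule submodsI) simp
  ultimately show ?thesis unfolding fg_submods_def by blast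
qed

lemma fg_submods_submods: "F \<in> fg_submods \<Longrightarrow> F \<in> submods"
  by (simp add: fg_submods_def)

lemma fg_submodsE:
  assumes "F \<in> fg_submods"
  obtains A where "finite A" "F = dscale.span A" "A \<subseteq> F"
  using assms dscale.span_superset unfolding fg_submods_def by blast

lemma fg_submodsI:
  assumes "finite A" "x \<in> dscale.span A" "x \<noteq> 0"
  shows "dscale.span A \<in> fg_submods"
  using assms submodsI[OF dscale.subspace_span] unfolding fg_submods_def by blast

text \<open>Generating sets unite, so \<open>F + G\<close> is again finitely generated. The last
  clause keeps \<open>H\<close> inside every submodule containing \<open>F\<close> and
  \<open>G\<close>; it makes the finitely generated submodules of a fixed \<open>E\<close> a
  directed family.\<close>

lemma fg_submods_sup:
  assumes "F \<in> fg_submods" "G \<in> fg_submods"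
  obtains H where "H \<in> fg_submods" "F \<subseteq> H" "G \<subseteq> H"
    "\<And>E. dscale.subspace E \<Longrightarrow> F \<subseteq> E \<Longrightarrow> G \<subseteq> E \<Longrightarrow> H \<subseteq> E"
proof -
  obtain A B where A: "finite A" "F = dscale.span A" "A \<subseteq> F"
    and B: "finite B" "G = dscale.span B" "B \<subseteq> G"
    using assms by (meson fg_submodsE)
  obtain x where "x \<in> F" "x \<noteq> 0"
    using assms(1) fg_submods_submods submods_nonzero by metis
  moreover have "F \<subseteq> dscale.span (A \<union> B)" "G \<subseteq> dscale.span (A \<union> B)"
    unfolding A(2) B(2) by (simp_all add: dscale.span_mono)
  moreover have "dscale.span (A \<union> B) \<subseteq> E" if "dscale.subspace E" "F \<subseteq> E" "G \<subseteq> E" for E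
    using that A(3) B(3) by (intro dscale.span_minimal) auto
  ultimately show thesis
    using that[of "dscale.span (A \<union> B)"] fg_submodsI[of "A \<union> B" x] A(1) B(1) by blast
qed

lemma span_mult_image: "dscale.span ((*) x ` A) = (*) x ` dscale.span A"
proof
  have "dscale.subspace ((*) x ` dscale.span A)"
    unfolding subspace_dscale_iff
  proof (intro conjI ballI allI)
    show "0 \<in> (*) x ` dscale.span A" using dscale.span_zero by force
  next
    fix y z assume "y \<in> (*) x ` dscale.span A" "z \<in> (*) x ` dscale.span A"
    then show "y + z \<in> (*) x ` dscale.span A"
      by (auto simp flip: distrib_left intro!: imageI dscale.span_add)
  next
    fix c y assume "y \<in> (*) x ` dscale.span A"
    then obtain z where z: "y = x * z" "z \<in> dscale.span A" by blast
    then have "to_fract c * z \<in> dscale.span A"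
      using dscale.span_scale[of z A c] by (simp add: dscale_def)
    moreover have "to_fract c * y = x * (to_fract c * z)"
      unfolding z(1) by (rule mult.left_commute)
    ultimately show "to_fract c * y \<in> (*) x ` dscale.span A" by (rule image_eqI[rotated])
  qed
  then show "dscale.span ((*) x ` A) \<subseteq> (*) x ` dscale.span A"
    by (intro dscale.span_minimal) (auto intro: dscale.span_base)
next
  have "x * y \<in> dscale.span ((*) x ` A)" if "y \<in> dscale.span A" for y
    using that
  proof (induction rule: dscale.span_induct_alt)
    case base
    then show ?case by (simp add: dscale.span_zero)
  next
    case (step c y z)
    have "dscale c (x * y) + x * z \<in> dscale.span ((*) x ` A)"
      by (intro dscale.span_add dscale.span_scale dscale.span_base step imageI)
    moreover have "dscale c (x * y) + x * z = x * (dscale c y + z)"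
      by (simp add: dscale_def algebra_simps)
    ultimately show ?case by metis
  qed
  then show "(*) x ` dscale.span A \<subseteq> dscale.span ((*) x ` A)" by blast
qed

lemma submods_mult_image:
  assumes "E \<in> submods" "x \<noteq> 0"
  shows "(*) x ` E \<in> submods"
proof -
  have "(*) x ` E = dscale.span ((*) x ` E)"
    using assms(1) by (metis submods_subspace dscale.span_eq_iff span_mult_image)
  then have "dscale.subspace ((*) x ` E)" by (metis dscale.subspace_span)
  moreover obtain y where "y \<in> E" "y \<noteq> 0" using assms(1) by (rule submods_nonzero)
  ultimately show ?thesis using assms(2) by (intro submodsI[of _ "x * y"]) auto
qed

lemma fg_submods_mult_image:
  assumes "F \<in> fg_submods" "x \<noteq> 0"
  shows "(*) x ` F \<in> fg_submods"
proof -
  obtain A where "finite A" "F = dscale.span A" using assms(1) by (rule fg_submodsE)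
  then have "finite ((*) x ` A)" "(*) x ` F = dscale.span ((*) x ` A)"
    by (simp_all add: span_mult_image)
  moreover have "(*) x ` F \<in> submods"
    using assms by (intro submods_mult_image fg_submods_submods)
  ultimately show ?thesis unfolding fg_submods_def by blast
qed

section \<open>Products of submodules and their generators\<close>

lemma mod_prod_subset:
  assumes "dscale.subspace G" "\<And>x y. x \<in> E \<Longrightarrow> y \<in> F \<Longrightarrow> x * y \<in> G"
  shows "mod_prod E F \<subseteq> G"
  unfolding mod_prod_def using assms by (intro dscale.span_minimal) auto

lemma mod_prodI: "x \<in> E \<Longrightarrow> y \<in> F \<Longrightarrow> x * y \<in> mod_prod E F"
  unfolding mod_prod_def by (rule dscale.span_base) blast

lemma subspace_mod_prod: "dscale.subspace (mod_prod E F)"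
  unfolding mod_prod_def by (rule dscale.subspace_span)

lemma mod_prod_mono_right: "F \<subseteq> F' \<Longrightarrow> mod_prod E F \<subseteq> mod_prod E F'"
  by (intro mod_prod_subset subspace_mod_prod mod_prodI) auto

lemma subspace_mult_preimage:
  assumes "dscale.subspace G"
  shows "dscale.subspace {y. \<forall>x\<in>S. x * y \<in> G}"
  using assms unfolding subspace_dscale_iff
  by (simp add: distrib_left) (metis mult.left_commute)

text \<open>Bilinear extension in two passes: by \<open>subspace_mult_preimage\<close> the elements
  that multiply a given set into \<open>G\<close> form a submodule, so first \<open>B\<close> and
  then \<open>A\<close> may be replaced by its span.\<close>

lemma span_mult_subset:
  assumes "dscale.subspace G" "\<And>x y. x \<in> A \<Longrightarrow> y \<in> B \<Longrightarrow> x * y \<in> G"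
    "x \<in> dscale.span A" "y \<in> dscale.span B"
  shows "x * y \<in> G"
proof -
  have "B \<subseteq> {y. \<forall>x\<in>A. x * y \<in> G}" using assms(2) by blast
  then have "dscale.span B \<subseteq> {y. \<forall>x\<in>A. x * y \<in> G}"
    by (rule dscale.span_minimal[OF _ subspace_mult_preimage[OF assms(1)]])
  then have "A \<subseteq> {x. \<forall>y\<in>dscale.span B. y * x \<in> G}"
    by (subst mult.commute) blast
  then have "dscale.span A \<subseteq> {x. \<forall>y\<in>dscale.span B. y * x \<in> G}"
    by (rule dscale.span_minimal[OF _ subspace_mult_preimage[OF assms(1)]])
  with assms(3,4) have "y * x \<in> G" by blast
  then show ?thesis by (simp only: mult.commute)
qed

lemma mod_prod_span_span: "mod_prod (dscale.span A) (dscale.span B) = dscale.span {x * y |x y. x \<in> A \<and> y \<in> B}"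
  (is "_ = dscale.span ?P")
proof
  show "mod_prod (dscale.span A) (dscale.span B) \<subseteq> dscale.span ?P"
    by (rule mod_prod_subset[OF dscale.subspace_span], rule span_mult_subset[of "dscale.span ?P" A B])
      (blast intro: dscale.span_base dscale.subspace_span)+
  show "dscale.span ?P \<subseteq> mod_prod (dscale.span A) (dscale.span B)"
    unfolding mod_prod_def by (intro dscale.span_mono) (auto intro: dscale.span_base)
qed

lemma fg_submods_mod_prod:
  assumes "F \<in> fg_submods" "G \<in> fg_submods"
  shows "mod_prod F G \<in> fg_submods"
proof -
  obtain A B where A: "finite A" "F = dscale.span A" and B: "finite B" "G = dscale.span B"
    using assms by (meson fg_submodsE)
  have "finite {x * y |x y. x \<in> A \<and> y \<in> B}"
    using A(1) B(1) by (intro finite_image_set2) simp_all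
  moreover have "mod_prod F G \<in> submods"
    using assms by (intro mod_prod_submods fg_submods_submods)
  ultimately show ?thesis
    using mod_prod_span_span[of A B] A(2) B(2) unfolding fg_submods_def by blast
qed

text \<open>A member of \<open>mod_prod F E\<close> is a finite sum of multiples of products, hence
  involves only finitely many elements of \<open>E\<close>. This later cuts \<open>mod_inv F\<close>
  down to a finite subset.\<close>

lemma mod_prod_finite_subset:
  assumes "finite A" "A \<subseteq> mod_prod F E"
  obtains B where "finite B" "B \<subseteq> E" "A \<subseteq> mod_prod F (dscale.span B)"
proof -
  have single: "\<exists>B. finite B \<and> B \<subseteq> E \<and> a \<in> mod_prod F (dscale.span B)"
    if "a \<in> mod_prod F E" for a
    using that unfolding mod_prod_def[of F E]
  proof (induction rule: dscale.span_induct_alt)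
    case base
    then show ?case using subspace_mod_prod dscale.subspace_0 by blast
  next
    case (step c y z)
    then obtain B u v where B: "finite B" "B \<subseteq> E" "z \<in> mod_prod F (dscale.span B)"
      and uv: "y = u * v" "u \<in> F" "v \<in> E" by blast
    let ?B = "insert v B"
    have "z \<in> mod_prod F (dscale.span ?B)"
      using B(3) mod_prod_mono_right[OF dscale.span_mono[OF subset_insertI]] by blast
    moreover have "y \<in> mod_prod F (dscale.span ?B)"
      unfolding uv(1) using uv(2) by (intro mod_prodI dscale.span_base) auto
    ultimately have "dscale c y + z \<in> mod_prod F (dscale.span ?B)"
      using subspace_mod_prod by (intro dscale.subspace_add dscale.subspace_scale)
    with B uv show ?case by (intro exI[of _ ?B]) auto
  qed
  then obtain B where B: "\<And>a. a \<in> A \<Longrightarrow> finite (B a) \<and> B a \<subseteq> E \<and> a \<in> mod_prod F (dscale.span (B a))"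
    using assms(2) by (metis subsetD)
  have "A \<subseteq> mod_prod F (dscale.span (\<Union>a\<in>A. B a))"
  proof
    fix a assume "a \<in> A"
    then have "B a \<subseteq> (\<Union>a\<in>A. B a)" by blast
    with B[OF \<open>a \<in> A\<close>] show "a \<in> mod_prod F (dscale.span (\<Union>a\<in>A. B a))"
      using mod_prod_mono_right[OF dscale.span_mono] by blast
  qed
  with that[of "\<Union>a\<in>A. B a"] B assms(1) show thesis by blast
qed

section \<open>Ideals and localizations\<close>

lemma subspace_to_fract_image: "dscale.subspace (to_fract ` I) \<longleftrightarrow> dideal I"
proof -
  have "to_fract c \<in> to_fract ` I \<longleftrightarrow> c \<in> I" for c by auto
  then show ?thesis
    unfolding subspace_dscale_iff dideal_iff
    by (simp add: ball_simps flip: to_fract_0 to_fract_add to_fract_mult)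
qed

lemma dideal_submods:
  assumes "dideal I" "I \<noteq> {0}"
  shows "to_fract ` I \<in> submods"
proof -
  obtain x where "x \<in> I" "x \<noteq> 0" using assms by (auto simp: dideal_iff)
  moreover have "dscale.subspace (to_fract ` I)"
    using assms(1) by (simp add: subspace_to_fract_image)
  ultimately show ?thesis by (intro submodsI[of _ "to_fract x"]) auto
qed

lemma quasi_ideal_submods: "quasi_ideal star I \<Longrightarrow> to_fract ` I \<in> submods"
  unfolding quasi_ideal_def by (simp add: dideal_submods)

lemma dideal_UNIV_iff: "dideal I \<Longrightarrow> I = UNIV \<longleftrightarrow> 1 \<in> I"
  unfolding dideal_iff by (metis UNIV_I UNIV_eq_I mult.right_neutral)

lemma quasi_idealD:
  assumes "quasi_ideal star I" "to_fract d \<in> star (to_fract ` I)"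
  shows "d \<in> I"
proof -
  have "to_fract d \<in> star (to_fract ` I) \<inter> base_ring"
    using assms(2) by (simp add: base_ring_def)
  with assms(1) show ?thesis by (auto simp: quasi_ideal_def)
qed

lemma quasi_ideal_one_notin:
  assumes "quasi_ideal star I" "I \<noteq> UNIV"
  shows "1 \<notin> star (to_fract ` I)"
  using assms quasi_idealD[of star I 1] dideal_UNIV_iff[of I] by (auto simp: quasi_ideal_def)

lemma SpecD:
  assumes "Q \<in> Spec"
  shows "0 \<in> Q" "1 \<notin> Q" "s \<notin> Q \<Longrightarrow> t \<notin> Q \<Longrightarrow> s * t \<notin> Q"
  using assms dideal_UNIV_iff[of Q] by (auto simp: Spec_def dideal_iff)

lemma localization_iff:
  assumes "Q \<in> Spec"
  shows "x \<in> localization Q \<longleftrightarrow> (\<exists>s. s \<notin> Q \<and> to_fract s * x \<in> base_ring)"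
proof
  assume "x \<in> localization Q"
  then obtain a s where "x = to_fract a / to_fract s" "s \<notin> Q"
    unfolding localization_def by blast
  moreover from this have "s \<noteq> 0" using SpecD(1)[OF assms] by blast
  ultimately show "\<exists>s. s \<notin> Q \<and> to_fract s * x \<in> base_ring"
    by (intro exI[of _ s]) (simp add: base_ring_def)
next
  assume "\<exists>s. s \<notin> Q \<and> to_fract s * x \<in> base_ring"
  then obtain s a where s: "s \<notin> Q" "to_fract s * x = to_fract a"
    unfolding base_ring_def by blast
  then have "s \<noteq> 0" using SpecD(1)[OF assms] by blast
  with s(2) have "x = to_fract a / to_fract s" by (simp add: field_simps)
  with s(1) show "x \<in> localization Q" unfolding localization_def by blast
qed

text \<open>The right-hand side is itself a submodule, because denominators \<open>s\<close> and
  \<open>t\<close> outside the prime \<open>Q\<close> have their product outside \<open>Q\<close>.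
  The span thus collapses to one common denominator.\<close>

lemma mod_prod_localization:
  assumes "Q \<in> Spec" "dscale.subspace E"
  shows "mod_prod E (localization Q) = {x. \<exists>s. s \<notin> Q \<and> to_fract s * x \<in> E}" (is "_ = ?R")
proof
  note E = assms(2)[unfolded subspace_dscale_iff]
  have "dscale.subspace ?R"
    unfolding subspace_dscale_iff
  proof (intro conjI ballI allI)
    show "0 \<in> ?R" using E SpecD(2)[OF assms(1)] by auto
  next
    fix x y assume "x \<in> ?R" "y \<in> ?R"
    then obtain s t where st: "s \<notin> Q" "to_fract s * x \<in> E" "t \<notin> Q" "to_fract t * y \<in> E" by blast
    then have "to_fract t * (to_fract s * x) + to_fract s * (to_fract t * y) \<in> E"
      using E by blast
    then have "to_fract (s * t) * (x + y) \<in> E" by (simp add: algebra_simps)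
    with st SpecD(3)[OF assms(1)] show "x + y \<in> ?R" by blast
  next
    fix c x assume "x \<in> ?R"
    then obtain s where s: "s \<notin> Q" "to_fract s * x \<in> E" by blast
    then have "to_fract c * (to_fract s * x) \<in> E" using E by blast
    with s(1) show "to_fract c * x \<in> ?R" by (auto simp: mult.left_commute)
  qed
  moreover have "x * y \<in> ?R" if x: "x \<in> E" and y: "y \<in> localization Q" for x y
  proof -
    obtain s a where s: "s \<notin> Q" "to_fract s * y = to_fract a"
      using y unfolding localization_iff[OF assms(1)] base_ring_def by blast
    have "to_fract a * x \<in> E" using E x by blast
    then have "to_fract s * (x * y) \<in> E" unfolding s(2)[symmetric] by (simp add: ac_simps)
    with s(1) show ?thesis by blast
  qed
  ultimately show "mod_prod E (localization Q) \<subseteq> ?R" by (rule mod_prod_subset)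
next
  show "?R \<subseteq> mod_prod E (localization Q)"
  proof
    fix x assume "x \<in> ?R"
    then obtain s where s: "s \<notin> Q" "to_fract s * x \<in> E" by blast
    then have s0: "s \<noteq> 0" using SpecD(1)[OF assms(1)] by blast
    have "1 / to_fract s \<in> localization Q"
      unfolding localization_def using s(1) by (metis (mono_tags, lifting) mem_Collect_eq to_fract_1)
    then have "to_fract s * x * (1 / to_fract s) \<in> mod_prod E (localization Q)"
      using s(2) by (intro mod_prodI)
    with s0 show "x \<in> mod_prod E (localization Q)" by simp
  qed
qed

lemma spectral_iff:
  assumes "Y \<subseteq> Spec" "E \<in> submods"
  shows "x \<in> spectral Y E \<longleftrightarrow> (\<forall>Q\<in>Y. \<exists>s. s \<notin> Q \<and> to_fract s * x \<in> E)"
  unfolding spectral_def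
  using assms by (auto simp: mod_prod_localization submods_subspace subset_iff)

text \<open>Extending \<open>D\<close> to \<open>localization Q\<close> gives
  \<open>localization Q\<close> itself, so \<open>Theta\<close> is a spectral closure. This links
  sharpness to the operations under comparison.\<close>

lemma Theta_iff:
  assumes "nabla star P \<subseteq> Spec"
  shows "x \<in> Theta star P \<longleftrightarrow> x \<in> spectral (nabla star P) base_ring"
  using assms unfolding Theta_def spectral_iff[OF assms fg_submods_submods[OF base_ring_fg]]
  by (auto simp: localization_iff subset_iff)

section \<open>Semistar operations\<close>

lemma
  assumes "semistar star" "E \<in> submods"
  shows semistar_submods: "star E \<in> submods"
    and semistar_mult: "x \<noteq> 0 \<Longrightarrow> star ((*) x ` E) = (*) x ` star E"
    and semistar_mono: "F \<in> submods \<Longrightarrow> E \<subseteq> F \<Longrightarrow> star E \<subseteq> star F"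
    and semistar_extensive: "E \<subseteq> star E"
    and semistar_idem: "star (star E) = star E"
  using assms by (auto simp: semistar_def)

lemma semistar_subset:
  assumes "semistar star" "E \<in> submods" "F \<in> submods" "E \<subseteq> star F"
  shows "star E \<subseteq> star F"
  using assms semistar_mono[of star E "star F"] by (simp add: semistar_submods semistar_idem)

text \<open>If \<open>x\<close> multiplies \<open>F\<close> into \<open>star E\<close>, then scaling
  and idempotence show that it multiplies \<open>star F\<close> there too. Hence the divisor in the
  formula for \<open>star_a\<close> can be taken to be \<open>H\<close> in place of its
  closure.\<close>

lemma colon_star:
  assumes "semistar star" "E \<in> submods" "F \<in> submods"
  shows "colon (star E) (star F) = colon (star E) F"
proof
  show "colon (star E) (star F) \<subseteq> colon (star E) F"
    using semistar_extensive[OF assms(1,3)] by (auto simp: colon_def)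
  show "colon (star E) F \<subseteq> colon (star E) (star F)"
  proof
    fix x assume x: "x \<in> colon (star E) F"
    show "x \<in> colon (star E) (star F)"
    \<comment> \<open>Compatibility with scaling is available for nonzero \<open>x\<close>
      only.\<close>
    proof (cases "x = 0")
      case True
      then show ?thesis
        using semistar_submods[OF assms(1,2)]
        by (auto simp: colon_def intro: submods_subspace dscale.subspace_0)
    next
      case False
      have "(*) x ` F \<subseteq> star E" using x by (auto simp: colon_def)
      then have "(*) x ` star F \<subseteq> star E"
        using assms False semistar_subset[of star "(*) x ` F" E]
        by (simp add: semistar_mult submods_mult_image)
      then show ?thesis by (auto simp: colon_def)
    qed
  qed
qed

section \<open>Spectral operations as semistar operations\<close>

lemma spectral_extensive:
  assumes "Y \<subseteq> Spec" "E \<in> submods"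
  shows "E \<subseteq> spectral Y E"
proof
  fix x assume "x \<in> E"
  moreover have "1 \<notin> Q" if "Q \<in> Y" for Q using that assms(1) SpecD(2) by blast
  ultimately show "x \<in> spectral Y E"
    unfolding spectral_iff[OF assms] by (auto intro!: exI[of _ 1])
qed

lemma spectral_semistar:
  assumes "Y \<subseteq> Spec"
  shows "semistar (spectral Y)"
proof -
  have sub: "spectral Y E \<in> submods" if E: "E \<in> submods" for E
  proof -
    have "dscale.subspace (spectral Y E)"
      unfolding spectral_def by (intro dscale.subspace_Inter) (auto intro: subspace_mod_prod)
    moreover obtain x where "x \<in> E" "x \<noteq> 0" using E by (rule submods_nonzero)
    moreover have "E \<subseteq> spectral Y E" using assms E by (rule spectral_extensive)
    ultimately show ?thesis by (intro submodsI) auto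
  qed
  show ?thesis
    unfolding semistar_def
  proof (intro conjI ballI allI impI)
    fix E :: "'a fract set" assume E: "E \<in> submods"
    then show "spectral Y E \<in> submods" by (rule sub)
    show "E \<subseteq> spectral Y E" using assms E by (rule spectral_extensive)
    show "spectral Y (spectral Y E) = spectral Y E"
    proof
      show "spectral Y E \<subseteq> spectral Y (spectral Y E)"
        using assms sub[OF E] by (rule spectral_extensive)
      show "spectral Y (spectral Y E) \<subseteq> spectral Y E"
      proof
        fix x assume x: "x \<in> spectral Y (spectral Y E)"
        \<comment> \<open>Two successive denominators \<open>s\<close> and \<open>t\<close> outside
          \<open>Q\<close> combine into \<open>t * s\<close>, again outside the prime
          \<open>Q\<close>.\<close>
        have "\<exists>s. s \<notin> Q \<and> to_fract s * x \<in> E" if Q: "Q \<in> Y" for Q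
        proof -
          obtain s where s: "s \<notin> Q" "to_fract s * x \<in> spectral Y E"
            using x Q unfolding spectral_iff[OF assms sub[OF E]] by blast
          then obtain t where t: "t \<notin> Q" "to_fract t * (to_fract s * x) \<in> E"
            using Q unfolding spectral_iff[OF assms E] by blast
          moreover have "Q \<in> Spec" using Q assms by blast
          ultimately show ?thesis
            using SpecD(3)[of Q t s] s(1) by (intro exI[of _ "t * s"]) (simp add: mult.assoc)
        qed
        then show "x \<in> spectral Y E" by (simp add: spectral_iff[OF assms E])
      qed
    qed
    show "spectral Y ((*) x ` E) = (*) x ` spectral Y E" if x: "x \<noteq> 0" for x
    proof -
      have mem: "z \<in> (*) x ` A \<longleftrightarrow> z / x \<in> A" for z A
        using x by (auto simp: image_iff intro!: bexI[of _ "z / x"])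
      show ?thesis
        by (rule set_eqI) (simp add: mem spectral_iff[OF assms] E submods_mult_image x)
    qed
    show "spectral Y E \<subseteq> spectral Y F" if "F \<in> submods" "E \<subseteq> F" for F
      using that(2) unfolding spectral_iff[OF assms E] spectral_iff[OF assms that(1)] subset_iff
      by meson
  qed
qed

lemma spectral_antimono: "Y \<subseteq> Z \<Longrightarrow> spectral Z E \<subseteq> spectral Y E"
  unfolding spectral_def by blast

subsection \<open>Operations of finite type\<close>

lemma star_f_iff: "x \<in> star_f star E \<longleftrightarrow> (\<exists>F. F \<in> fg_submods \<and> F \<subseteq> E \<and> x \<in> star F)"
  unfolding star_f_def by blast

lemma star_f_mono: "E \<subseteq> F \<Longrightarrow> star_f star E \<subseteq> star_f star F"
  unfolding star_f_def by blast

lemma star_f_fg: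
  assumes "semistar star" "F \<in> fg_submods"
  shows "star_f star F = star F"
  using assms semistar_mono[OF assms(1)] fg_submods_submods by (fastforce simp: star_f_iff)

text \<open>A finite subset of a directed union lies in one member: \<open>fg_submods_sup\<close>
  gives directedness, and \<open>star\<close> is monotone.\<close>

lemma star_f_finite_subset:
  assumes "semistar star" "E \<in> submods" "finite A" "A \<subseteq> star_f star E"
  obtains G where "G \<in> fg_submods" "G \<subseteq> E" "A \<subseteq> star G"
  using assms(3,4)
proof (induction A arbitrary: thesis rule: finite_induct)
  case empty
  \<comment> \<open>\<open>G\<close> has to be nonzero even when no element is prescribed.\<close>
  obtain x where x: "x \<in> E" "x \<noteq> 0" using assms(2) by (rule submods_nonzero)
  have "dscale.span {x} \<subseteq> E"
    using x assms(2) by (intro dscale.span_minimal) (auto intro: submods_subspace)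
  then show ?case using empty fg_submodsI[of "{x}" x] x(2) by (auto intro: dscale.span_base)
next
  case (insert a A)
  from insert.prems(2) have "A \<subseteq> star_f star E" by blast
  then obtain G where G: "G \<in> fg_submods" "G \<subseteq> E" "A \<subseteq> star G" using insert.IH by blast
  obtain F where F: "F \<in> fg_submods" "F \<subseteq> E" "a \<in> star F"
    using insert.prems(2) by (auto simp: star_f_iff)
  obtain H where H: "H \<in> fg_submods" "F \<subseteq> H" "G \<subseteq> H" "H \<subseteq> E"
    using fg_submods_sup[OF F(1) G(1)] submods_subspace[OF assms(2)] F(2) G(2) by metis
  note fg = fg_submods_submods[OF F(1)] fg_submods_submods[OF G(1)] fg_submods_submods[OF H(1)]
  have "star F \<subseteq> star H" using assms(1) fg(1,3) H(2) by (rule semistar_mono)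
  moreover have "star G \<subseteq> star H" using assms(1) fg(2,3) H(3) by (rule semistar_mono)
  ultimately have "insert a A \<subseteq> star H" using G(3) F(3) by blast
  with H(1,4) show ?case by (rule insert.prems(1))
qed

lemma star_f_semistar:
  assumes "semistar star"
  shows "semistar (star_f star)"
proof -
  have ext: "E \<subseteq> star_f star E" if E: "E \<in> submods" for E
  proof
    fix x assume x: "x \<in> E"
    \<comment> \<open>The nonzero \<open>y\<close> keeps the span nonzero in case
      \<open>x = 0\<close>.\<close>
    obtain y where y: "y \<in> E" "y \<noteq> 0" using E by (rule submods_nonzero)
    let ?F = "dscale.span {x, y}"
    have "?F \<in> fg_submods" using y by (intro fg_submodsI[of _ y]) (auto intro: dscale.span_base)
    moreover have "?F \<subseteq> E"
      using x y E by (intro dscale.span_minimal) (auto intro: submods_subspace)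
    moreover have "x \<in> ?F" by (rule dscale.span_base) simp
    ultimately show "x \<in> star_f star E"
      unfolding star_f_iff using semistar_extensive[OF assms] fg_submods_submods by blast
  qed
  have sub: "star_f star E \<in> submods" if E: "E \<in> submods" for E
  proof -
    have "dscale.subspace (star_f star E)"
      unfolding subspace_dscale_iff
    proof (intro conjI ballI allI)
      have "0 \<in> E" using E by (intro dscale.subspace_0 submods_subspace)
      with ext[OF E] show "0 \<in> star_f star E" by blast
    next
      fix x y assume "x \<in> star_f star E" "y \<in> star_f star E"
      then have "finite {x, y}" "{x, y} \<subseteq> star_f star E" by simp_all
      then obtain G where G: "G \<in> fg_submods" "G \<subseteq> E" "{x, y} \<subseteq> star G"
        using star_f_finite_subset[OF assms E] by metis
      have "star G \<in> submods" by (rule semistar_submods[OF assms fg_submods_submods[OF G(1)]])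
      then have "x + y \<in> star G" using G(3) by (intro dscale.subspace_add submods_subspace) auto
      with G show "x + y \<in> star_f star E" unfolding star_f_iff by blast
    next
      fix c x assume "x \<in> star_f star E"
      then obtain G where G: "G \<in> fg_submods" "G \<subseteq> E" "x \<in> star G" by (auto simp: star_f_iff)
      have "star G \<in> submods" by (rule semistar_submods[OF assms fg_submods_submods[OF G(1)]])
      then have "to_fract c * x \<in> star G" using G(3) by (rule to_fract_mult_closed)
      with G show "to_fract c * x \<in> star_f star E" unfolding star_f_iff by blast
    qed
    moreover obtain x where "x \<in> E" "x \<noteq> 0" using E by (rule submods_nonzero)
    ultimately show ?thesis using ext[OF E] by (intro submodsI) auto
  qed
  have mult: "(*) x ` star_f star E \<subseteq> star_f star ((*) x ` E)" if x: "x \<noteq> 0" for x E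
  proof
    fix z assume "z \<in> (*) x ` star_f star E"
    then obtain y where y: "z = x * y" "y \<in> star_f star E" by blast
    then obtain F where F: "F \<in> fg_submods" "F \<subseteq> E" "z \<in> (*) x ` star F"
      unfolding star_f_iff by blast
    with assms x have "z \<in> star ((*) x ` F)" by (simp add: semistar_mult fg_submods_submods)
    with F(1,2) x show "z \<in> star_f star ((*) x ` E)"
      unfolding star_f_iff by (blast intro: fg_submods_mult_image)
  qed
  show ?thesis
    unfolding semistar_def
  proof (intro conjI ballI allI impI)
    fix E :: "'a fract set" assume E: "E \<in> submods"
    show "star_f star E \<in> submods" using E by (rule sub)
    show "E \<subseteq> star_f star E" using E by (rule ext)
    show "star_f star E \<subseteq> star_f star F" if "E \<subseteq> F" for F using that by (rule star_f_mono)
    show "star_f star (star_f star E) = star_f star E"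
    proof
      show "star_f star (star_f star E) \<subseteq> star_f star E"
      proof
        fix x assume "x \<in> star_f star (star_f star E)"
        then obtain F where F: "F \<in> fg_submods" "F \<subseteq> star_f star E" "x \<in> star F"
          by (auto simp: star_f_iff)
        \<comment> \<open>The finitely many generators of \<open>F\<close> lie in the closure of a
          single \<open>G\<close>, so idempotence of \<open>star\<close> at \<open>G\<close>
          suffices.\<close>
        obtain A where A: "finite A" "F = dscale.span A" "A \<subseteq> F" using F(1) by (rule fg_submodsE)
        from A(3) F(2) have "A \<subseteq> star_f star E" by blast
        then obtain G where G: "G \<in> fg_submods" "G \<subseteq> E" "A \<subseteq> star G"
          using star_f_finite_subset[OF assms E A(1)] by blast
        have "F \<subseteq> star G"
          unfolding A(2) using G(3)
            submods_subspace[OF semistar_submods[OF assms fg_submods_submods[OF G(1)]]]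
          by (rule dscale.span_minimal)
        then have "star F \<subseteq> star G"
          by (rule semistar_subset[OF assms fg_submods_submods[OF F(1)] fg_submods_submods[OF G(1)]])
        with F(3) G show "x \<in> star_f star E" unfolding star_f_iff by blast
      qed
    qed (rule ext[OF sub[OF E]])
    show "star_f star ((*) x ` E) = (*) x ` star_f star E" if x: "x \<noteq> 0" for x
    proof
      \<comment> \<open>The reverse inclusion is \<open>mult\<close> for \<open>inverse x\<close>,
        applied to \<open>E\<close> scaled by \<open>x\<close>.\<close>
      have "(*) (inverse x) ` star_f star ((*) x ` E) \<subseteq> star_f star E"
        using mult[of "inverse x" "(*) x ` E"] x by (simp add: image_image flip: mult.assoc)
      then have "(*) x ` (*) (inverse x) ` star_f star ((*) x ` E) \<subseteq> (*) x ` star_f star E"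
        by (rule image_mono)
      then show "star_f star ((*) x ` E) \<subseteq> (*) x ` star_f star E"
        using x by (simp add: image_image flip: mult.assoc)
    qed (rule mult[OF x])
  qed
qed


section \<open>Dependence of the derived operations on the given one\<close>

lemma star_f_cong:
  assumes "\<And>F. F \<in> fg_submods \<Longrightarrow> star1 F = star2 F"
  shows "star_f star1 = star_f star2"
  using assms unfolding star_f_def by (intro ext) blast

lemma star_f_op_le:
  assumes "op_le star1 star2"
  shows "op_le (star_f star1) (star_f star2)"
  using assms fg_submods_submods unfolding op_le_def star_f_def by blast

text \<open>The formula evaluates the operation only at \<open>H\<close> and at
  \<open>mod_prod F H\<close>, both finitely generated.\<close>

lemma star_a_cong:
  assumes "\<And>F. F \<in> fg_submods \<Longrightarrow> star1 F = star2 F"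
  shows "star_a star1 = star_a star2"
proof -
  have "star_a_fg star1 F = star_a_fg star2 F" if "F \<in> fg_submods" for F
    using assms fg_submods_mod_prod[OF that] unfolding star_a_fg_def
    by (metis (no_types, opaque_lifting))
  then show ?thesis unfolding star_a_def by (intro ext) (metis (no_types, opaque_lifting))
qed

text \<open>A colon shrinks when its divisor grows, so enlarging the operation has opposing effects.
  \<open>colon_star\<close> resolves this by replacing the divisor \<open>star H\<close> with
  \<open>H\<close>, which is the same for both operations.\<close>

lemma star_a_op_le:
  assumes "semistar star1" "semistar star2" "op_le star1 star2"
  shows "op_le (star_a star1) (star_a star2)"
proof -
  have "colon (star1 (mod_prod F H)) (star1 H) \<subseteq> colon (star2 (mod_prod F H)) (star2 H)"
    if "F \<in> fg_submods" "H \<in> fg_submods" for F H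
  proof -
    have "H \<in> submods" "mod_prod F H \<in> submods"
      using that by (simp_all add: fg_submods_submods mod_prod_submods)
    then have "star1 (mod_prod F H) \<subseteq> star2 (mod_prod F H)"
      and "colon (star1 (mod_prod F H)) (star1 H) = colon (star1 (mod_prod F H)) H"
      and "colon (star2 (mod_prod F H)) (star2 H) = colon (star2 (mod_prod F H)) H"
      using assms by (simp_all add: op_le_def colon_star)
    then show ?thesis by (auto simp: colon_def)
  qed
  then have "star_a_fg star1 F \<subseteq> star_a_fg star2 F" if "F \<in> fg_submods" for F
    using that unfolding star_a_fg_def by blast
  then show ?thesis unfolding op_le_def star_a_def by blast
qed

subsection \<open>Quasi-ideals\<close>

text \<open>The witness is the contraction to \<open>D\<close> of the closure of \<open>I\<close>;
  idempotence makes it a quasi-ideal.\<close>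

lemma quasi_ideal_closure:
  assumes "semistar star" "dideal I" "I \<noteq> {0}"
  obtains J where "quasi_ideal star J" "I \<subseteq> J" "J = UNIV \<longleftrightarrow> 1 \<in> star (to_fract ` I)"
proof -
  define J where "J = {d. to_fract d \<in> star (to_fract ` I)}"
  have I: "to_fract ` I \<in> submods" using assms(2,3) by (rule dideal_submods)
  have sI: "star (to_fract ` I) \<in> submods" using assms(1) I by (rule semistar_submods)
  have J: "dideal J"
    using submods_subspace[OF sI] unfolding dideal_iff J_def subspace_dscale_iff by simp
  have IJ: "I \<subseteq> J" using semistar_extensive[OF assms(1) I] unfolding J_def by blast
  obtain d where d: "d \<in> I" "d \<noteq> 0" using assms(2,3) by (auto simp: dideal_iff)
  then have J0: "J \<noteq> {0}" using IJ by blast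
  have JI: "to_fract ` J \<subseteq> star (to_fract ` I)" unfolding J_def by blast
  have "star (to_fract ` J) \<subseteq> star (to_fract ` I)"
    using assms(1) dideal_submods[OF J J0] I JI by (rule semistar_subset)
  then have "star (to_fract ` J) \<inter> base_ring \<subseteq> to_fract ` J"
    unfolding J_def base_ring_def by blast
  moreover have "to_fract ` J \<subseteq> star (to_fract ` J)"
    using assms(1) dideal_submods[OF J J0] by (rule semistar_extensive)
  ultimately have "quasi_ideal star J"
    using J J0 unfolding quasi_ideal_def base_ring_def by blast
  moreover have "J = UNIV \<longleftrightarrow> 1 \<in> star (to_fract ` I)"
    unfolding dideal_UNIV_iff[OF J] by (simp add: J_def)
  ultimately show thesis using IJ that by blast
qed

lemma
  assumes "M \<in> QMax star"
  shows QMax_dideal: "dideal M"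
    and QMax_one_notin: "1 \<notin> star (to_fract ` M)"
proof -
  have "quasi_ideal star M" "M \<noteq> UNIV" using assms unfolding QMax_def by blast+
  then show "dideal M" "1 \<notin> star (to_fract ` M)"
    by (simp_all add: quasi_ideal_one_notin) (simp add: quasi_ideal_def)
qed

text \<open>Let \<open>a * b\<close> lie in \<open>M\<close> but not \<open>a\<close>. By maximality
  the quasi-ideal generated by \<open>M\<close> and \<open>a\<close> is all of \<open>D\<close>, so
  the closure of \<open>M + aD\<close> contains 1. Multiplication by \<open>b\<close> maps
  \<open>M + aD\<close> into \<open>M\<close>, hence \<open>b\<close> lies in the closure of
  \<open>M\<close>, and so in \<open>M\<close>.\<close>

lemma QMax_subset_Spec:
  assumes "semistar star"
  shows "QMax star \<subseteq> Spec"
proof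
  fix M assume "M \<in> QMax star"
  then have M: "quasi_ideal star M" "M \<noteq> UNIV"
    and max: "\<And>J. quasi_ideal star J \<Longrightarrow> J \<noteq> UNIV \<Longrightarrow> M \<subseteq> J \<Longrightarrow> J = M"
    unfolding QMax_def by auto
  then have dM: "dideal M" by (simp add: quasi_ideal_def)
  note dM' = dM[unfolded dideal_iff]
  have "b \<in> M" if ab: "a * b \<in> M" and a: "a \<notin> M" for a b
  \<comment> \<open>Scaling by \<open>b\<close> below needs \<open>b\<close> to be nonzero.\<close>
  proof (cases "b = 0")
    case True
    then show ?thesis using dM' by blast
  next
    case False
    define I where "I = {m + c * a |m c. m \<in> M}"
    have I: "dideal I"
      unfolding dideal_iff
    proof (intro conjI ballI allI)
      have "0 + 0 * a \<in> I" unfolding I_def using dM' by blast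
      then show "0 \<in> I" by simp
    next
      fix x y assume "x \<in> I" "y \<in> I"
      then obtain m c n e where *: "x = m + c * a" "y = n + e * a" "m \<in> M" "n \<in> M"
        unfolding I_def by blast
      then have "x + y = (m + n) + (c + e) * a" by (simp add: algebra_simps)
      moreover have "m + n \<in> M" using * dM' by blast
      ultimately show "x + y \<in> I" unfolding I_def by blast
    next
      fix e x assume "x \<in> I"
      then obtain m c where *: "x = m + c * a" "m \<in> M" unfolding I_def by blast
      then have "e * x = e * m + (e * c) * a" by (simp add: algebra_simps)
      moreover have "e * m \<in> M" using * dM' by blast
      ultimately show "e * x \<in> I" unfolding I_def by blast
    qed
    have "0 + 1 * a \<in> I" unfolding I_def using dM' by blast
    then have aI: "a \<in> I" by simp
    have "m + 0 * a \<in> I" if "m \<in> M" for m unfolding I_def using that by blast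
    then have MI: "M \<subseteq> I" by auto
    have I0: "I \<noteq> {0}" using aI a dM' by blast
    obtain J where J: "quasi_ideal star J" "I \<subseteq> J" "J = UNIV \<longleftrightarrow> 1 \<in> star (to_fract ` I)"
      using quasi_ideal_closure[OF assms I I0] by metis
    have "J \<noteq> M" using J(2) aI a by blast
    then have "J = UNIV" using max[OF J(1)] MI J(2) by blast
    then have one: "1 \<in> star (to_fract ` I)" using J(3) by blast
    have "b * (m + c * a) \<in> M" if "m \<in> M" for m c
    proof -
      have "b * m + c * (a * b) \<in> M" using dM' that ab by blast
      then show ?thesis by (simp add: algebra_simps)
    qed
    then have bI: "b * i \<in> M" if "i \<in> I" for i using that unfolding I_def by blast
    have "to_fract b * to_fract i \<in> to_fract ` M" if "i \<in> I" for i
      using bI[OF that] by (metis imageI to_fract_mult)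
    then have "(*) (to_fract b) ` to_fract ` I \<subseteq> to_fract ` M" by blast
    moreover have fI: "to_fract ` I \<in> submods" using I I0 by (rule dideal_submods)
    moreover have b0: "to_fract b \<noteq> 0" using False by simp
    ultimately have "star ((*) (to_fract b) ` to_fract ` I) \<subseteq> star (to_fract ` M)"
      using semistar_mono[OF assms] submods_mult_image quasi_ideal_submods[OF M(1)] by blast
    then have "(*) (to_fract b) ` star (to_fract ` I) \<subseteq> star (to_fract ` M)"
      using semistar_mult[OF assms fI b0] by simp
    then have "to_fract b * 1 \<in> star (to_fract ` M)" using one by blast
    then show ?thesis using quasi_idealD[OF M(1)] by simp
  qed
  then show "M \<in> Spec" using M(2) dM unfolding Spec_def by blast
qed

text \<open>Finite type is decisive: membership in the closure of the union is witnessed by a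
  finitely generated module, whose generators already lie in one member of the chain.\<close>

lemma quasi_ideal_Union_chain:
  assumes "C \<noteq> {}" "subset.chain A C" "\<And>J. J \<in> C \<Longrightarrow> quasi_ideal (star_f star) J"
    and "semistar star"
  shows "quasi_ideal (star_f star) (\<Union>C)"
proof -
  have "x + y \<in> \<Union>C" if "x \<in> \<Union>C" "y \<in> \<Union>C" for x y
  proof -
    have "{x, y} \<subseteq> \<Union>C" using that by blast
    then obtain J where "J \<in> C" "{x, y} \<subseteq> J"
      using finite_subset_Union_chain[of "{x, y}" C A] assms(1,2)
      by (metis finite.emptyI finite.insertI)
    moreover from this have "dideal J" using assms(3) by (simp add: quasi_ideal_def)
    ultimately show ?thesis by (auto simp: dideal_iff)
  qed
  moreover have dC: "dideal J" "J \<noteq> {0}" if "J \<in> C" for J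
    using that assms(3) by (auto simp: quasi_ideal_def)
  moreover have "c * x \<in> \<Union>C" if "x \<in> \<Union>C" for c x
    using that dC(1) unfolding dideal_iff by blast
  moreover obtain J where J: "J \<in> C" using assms(1) by blast
  then have "0 \<in> \<Union>C" using dC(1) unfolding dideal_iff by blast
  ultimately have d: "dideal (\<Union>C)" unfolding dideal_iff by blast
  obtain x where "x \<in> J" "x \<noteq> 0" using dC[OF J] by (auto simp: dideal_iff)
  then have n: "\<Union>C \<noteq> {0}" using J by blast
  have "star_f star (to_fract ` \<Union>C) \<inter> base_ring \<subseteq> to_fract ` \<Union>C"
  proof
    fix y assume y: "y \<in> star_f star (to_fract ` \<Union>C) \<inter> base_ring"
    then obtain F d where F: "F \<in> fg_submods" "F \<subseteq> to_fract ` \<Union>C" "y \<in> star F"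
      and yd: "y = to_fract d" by (auto simp: star_f_iff base_ring_def)
    obtain B where B: "finite B" "F = dscale.span B" "B \<subseteq> F" using F(1) by (rule fg_submodsE)
    then have "B \<subseteq> to_fract ` \<Union>C" using F(2) by blast
    then obtain B' where B': "finite B'" "B' \<subseteq> \<Union>C" "B = to_fract ` B'"
      using finite_subset_image[OF B(1)] by metis
    obtain J where J: "J \<in> C" "B' \<subseteq> J"
      using finite_subset_Union_chain[OF B'(1,2) assms(1,2)] by metis
    have "dscale.span B \<subseteq> to_fract ` J"
      using B'(3) J dC by (intro dscale.span_minimal) (auto simp: subspace_to_fract_image)
    then have "y \<in> star_f star (to_fract ` J)"
      using F(1,3) B(2) unfolding star_f_iff by blast
    then have "d \<in> J" using quasi_idealD[OF assms(3)[OF J(1)]] yd by blast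
    then show "y \<in> to_fract ` \<Union>C" using yd J(1) by blast
  qed
  moreover have "to_fract ` \<Union>C \<subseteq> star_f star (to_fract ` \<Union>C)"
    using star_f_semistar[OF assms(4)] dideal_submods[OF d n] by (rule semistar_extensive)
  ultimately show ?thesis
    using d n unfolding quasi_ideal_def base_ring_def by blast
qed

text \<open>Zorn's lemma for the proper quasi-ideals above \<open>I\<close>. The contracted closure
  of \<open>I\<close> shows that there are some, and unions of chains stay proper because no member
  contains 1.\<close>

lemma QMax_exists:
  assumes "semistar star" "dideal I" "I \<noteq> {0}" "1 \<notin> star_f star (to_fract ` I)"
  obtains M where "M \<in> QMax (star_f star)" "I \<subseteq> M"
proof -
  let ?A = "{J. quasi_ideal (star_f star) J \<and> J \<noteq> UNIV \<and> I \<subseteq> J}"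
  have "?A \<noteq> {}"
    using quasi_ideal_closure[OF star_f_semistar[OF assms(1)] assms(2,3)] assms(4) by blast
  moreover have "\<Union>C \<in> ?A" if C: "C \<noteq> {}" "subset.chain ?A C" for C
  proof -
    have CA: "J \<in> ?A" if "J \<in> C" for J using that C(2) by (auto simp: subset.chain_def)
    have "quasi_ideal (star_f star) (\<Union>C)"
      by (rule quasi_ideal_Union_chain[OF C _ assms(1)]) (use CA in blast)
    moreover have "1 \<notin> J" if "J \<in> C" for J
    proof -
      have "dideal J" "J \<noteq> UNIV" using CA[OF that] by (simp_all add: quasi_ideal_def)
      then show ?thesis using dideal_UNIV_iff by blast
    qed
    then have "\<Union>C \<noteq> UNIV" by blast
    ultimately show ?thesis using CA C(1) by blast
  qed
  ultimately have "\<exists>M\<in>?A. \<forall>X\<in>?A. M \<subseteq> X \<longrightarrow> X = M" by (rule subset_Zorn_nonempty)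
  then obtain M where M: "M \<in> ?A" "\<forall>X\<in>?A. M \<subseteq> X \<longrightarrow> X = M" by blast
  then have "M \<in> QMax (star_f star)" unfolding QMax_def by blast
  with M(1) that show thesis by blast
qed

section \<open>Conductor ideals and monotonicity of \<open>star_tilde\<close>\<close>

lemma dideal_colon:
  assumes "E \<in> submods"
  shows "dideal {d. to_fract d * x \<in> E}" "{d. to_fract d * x \<in> E} \<noteq> {0}"
proof -
  show "dideal {d. to_fract d * x \<in> E}"
    using submods_subspace[OF assms] unfolding dideal_iff subspace_dscale_iff
    by (simp add: distrib_right mult.assoc)
  \<comment> \<open>Clearing denominators in \<open>x\<close> and in a nonzero \<open>e\<close> of
    \<open>E\<close> gives the nonzero conductor element \<open>b * s\<close>: in \<open>K\<close>,
    \<open>(b * s) * x = b * a = (a * t) * e\<close>.\<close>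
  obtain e where e: "e \<in> E" "e \<noteq> 0" using assms by (rule submods_nonzero)
  obtain a s where s: "s \<noteq> 0" "to_fract s * x = to_fract a" by (rule fract_denominator)
  obtain b t where t: "t \<noteq> 0" "to_fract t * e = to_fract b" by (rule fract_denominator)
  have "to_fract b \<noteq> 0" unfolding t(2)[symmetric] using t(1) e(2) by simp
  then have bs: "b * s \<noteq> 0" using s(1) by simp
  have "to_fract (b * s) * x = to_fract (a * t) * e"
    by (simp add: mult.assoc s(2) t(2))
  also have "\<dots> \<in> E" using assms e(1) by (rule to_fract_mult_closed)
  finally show "{d. to_fract d * x \<in> E} \<noteq> {0}" using bs by blast
qed

text \<open>For \<open>x\<close> in the first closure of \<open>E\<close> the conductor ideal \<open>(E :\<^sub>D x)\<close> lies in no quasi-maximal ideal,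
  hence its closure contains 1; this property passes to the larger operation.\<close>

lemma star_tilde_op_le:
  assumes "semistar star1" "semistar star2" "op_le star1 star2"
  shows "op_le (star_tilde star1) (star_tilde star2)"
  unfolding op_le_def star_tilde_def
proof (intro ballI subsetI)
  fix E x assume E: "E \<in> submods" and x: "x \<in> spectral (QMax (star_f star1)) E"
  note Spec = QMax_subset_Spec[OF star_f_semistar]
  let ?I = "{d. to_fract d * x \<in> E}"
  have "\<not> ?I \<subseteq> M" if "M \<in> QMax (star_f star1)" for M
    using x that unfolding spectral_iff[OF Spec[OF assms(1)] E] by blast
  then have "1 \<in> star_f star1 (to_fract ` ?I)"
    using QMax_exists[OF assms(1) dideal_colon[OF E]] by blast
  moreover have "to_fract ` ?I \<in> submods" using dideal_colon[OF E] by (rule dideal_submods)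
  ultimately have one: "1 \<in> star_f star2 (to_fract ` ?I)"
    using star_f_op_le[OF assms(3)] unfolding op_le_def by blast
  have "\<not> ?I \<subseteq> M" if "M \<in> QMax (star_f star2)" for M
  proof -
    have "1 \<notin> star_f star2 (to_fract ` M)" using that by (rule QMax_one_notin)
    with one star_f_mono[OF image_mono] show ?thesis by blast
  qed
  then show "x \<in> spectral (QMax (star_f star2)) E"
    unfolding spectral_iff[OF Spec[OF assms(2)] E] by blast
qed

section \<open>The P\<open>\<star>\<close>MD property\<close>

lemma PstarMD_one:
  assumes "semistar star" "PstarMD star" "F \<in> fg_submods"
  shows "1 \<in> star_f star (mod_prod F (mod_inv F))"
proof -
  have "1 \<in> star base_ring"
    using semistar_extensive[OF assms(1) fg_submods_submods[OF base_ring_fg]] one_in_base_ring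
    by blast
  with assms(2,3) show ?thesis by (simp add: PstarMD_def)
qed

text \<open>If every product \<open>h * w\<close> lay in \<open>Q\<close>, then \<open>Q\<close>
  would contain the product of \<open>F\<close> and its inverse. The closure of \<open>Q\<close>
  would then contain 1, which is impossible for a proper quasi-ideal.\<close>

lemma PstarMD_invertible:
  assumes "semistar star" "PstarMD star" "F \<in> fg_submods" "Q \<in> QSpec (star_f star)"
  obtains h w d where "h \<in> F" "w \<in> mod_inv F" "d \<notin> Q" "h * w = to_fract d"
proof -
  have Q: "quasi_ideal (star_f star) Q" "Q \<noteq> UNIV"
    using assms(4) by (auto simp: QSpec_def Spec_def)
  have "\<not> mod_prod F (mod_inv F) \<subseteq> to_fract ` Q"
    using PstarMD_one[OF assms(1-3)] quasi_ideal_one_notin[OF Q] star_f_mono by blast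
  moreover have "dscale.subspace (to_fract ` Q)"
    using Q(1) by (simp add: subspace_to_fract_image quasi_ideal_def)
  ultimately obtain h w where hw: "h \<in> F" "w \<in> mod_inv F" "h * w \<notin> to_fract ` Q"
    using mod_prod_subset by metis
  then have "h * w \<in> base_ring" by (simp add: mod_inv_def colon_def mult.commute)
  then obtain d where "h * w = to_fract d" by (auto simp: base_ring_def)
  with hw that show thesis by blast
qed

section \<open>Comparison of the closures attached to \<nabla> and \<Delta>\<close>

lemma nabla_subset_Spec: "semistar star \<Longrightarrow> nabla star P \<subseteq> Spec"
  using QMax_subset_Spec unfolding nabla_def by blast

lemma spectral_Delta_eq_nabla:
  assumes "semistar star" "PstarMD star" "P \<in> QSpec (star_f star)"
    and "\<not> sharp (star_f star) P" "F \<in> fg_submods"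
  shows "spectral (Delta (star_f star) P) F = spectral (nabla (star_f star) P) F"
proof
  show "spectral (Delta (star_f star) P) F \<subseteq> spectral (nabla (star_f star) P) F"
    unfolding Delta_def by (intro spectral_antimono) blast
  have PS: "P \<in> Spec" using assms(3) by (simp add: QSpec_def)
  note NS = nabla_subset_Spec[OF star_f_semistar[OF assms(1)], of P]
  then have DS: "Delta (star_f star) P \<subseteq> Spec" using PS by (auto simp: Delta_def)
  note Fs = fg_submods_submods[OF assms(5)]
  obtain h w d where h: "h \<in> F" and w: "w \<in> mod_inv F" and d: "d \<notin> P" "h * w = to_fract d"
    using assms(1,2,5,3) by (rule PstarMD_invertible)
  show "spectral (nabla (star_f star) P) F \<subseteq> spectral (Delta (star_f star) P) F"
  proof
    fix y assume y: "y \<in> spectral (nabla (star_f star) P) F"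
    \<comment> \<open>Since \<open>w\<close> multiplies \<open>F\<close> into \<open>D\<close>, it
      multiplies the spectral closure of \<open>F\<close> into that of \<open>D\<close>, which is
      \<open>Theta\<close>.\<close>
    have "w * y \<in> spectral (nabla (star_f star) P) base_ring"
      unfolding spectral_iff[OF NS fg_submods_submods[OF base_ring_fg]]
    proof
      fix M assume "M \<in> nabla (star_f star) P"
      then obtain s where s: "s \<notin> M" "to_fract s * y \<in> F"
        using y unfolding spectral_iff[OF NS Fs] by blast
      then have "w * (to_fract s * y) \<in> base_ring" using w by (simp add: mod_inv_def colon_def)
      with s(1) show "\<exists>s. s \<notin> M \<and> to_fract s * (w * y) \<in> base_ring"
        by (auto simp: mult.left_commute)
    qed
    then have "w * y \<in> localization P"
      using assms(4) Theta_iff[OF NS] unfolding sharp_def by blast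
    then obtain s a where s: "s \<notin> P" "to_fract s * (w * y) = to_fract a"
      unfolding localization_iff[OF PS] base_ring_def by blast
    \<comment> \<open>Multiplying \<open>w * y\<close> back by \<open>h\<close> returns
      \<open>y\<close> up to the factor \<open>d\<close> outside \<open>P\<close>, so
      \<open>s * d\<close> is a denominator for \<open>y\<close>.\<close>
    have "to_fract (s * d) * y = h * (to_fract s * (w * y))"
      by (simp add: d(2)[symmetric] ac_simps)
    also have "\<dots> = to_fract a * h" by (simp add: s(2))
    also have "\<dots> \<in> F" using Fs h by (rule to_fract_mult_closed)
    finally have "\<exists>t. t \<notin> P \<and> to_fract t * y \<in> F" using SpecD(3)[OF PS s(1) d(1)] by blast
    moreover have "\<forall>M\<in>nabla (star_f star) P. \<exists>t. t \<notin> M \<and> to_fract t * y \<in> F"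
      using y by (simp only: spectral_iff[OF NS Fs])
    ultimately show "y \<in> spectral (Delta (star_f star) P) F"
      by (simp only: spectral_iff[OF DS Fs]) (simp add: Delta_def)
  qed
qed

text \<open>Write \<open>F = D + xD\<close>. The witness comes from finitely many elements of \<open>F\<^sup>-\<^sup>1 = (D : x)\<close> that suffice
  for 1 to lie in the \<open>star_f\<close>-closure of \<open>F F\<^sup>-\<^sup>1\<close>; at a prime where \<open>x\<close> is integral, \<open>F F\<^sup>-\<^sup>1\<close> and \<open>F\<^sup>-\<^sup>1\<close>
  agree locally.\<close>

lemma PstarMD_finite_conductor:
  assumes "semistar star" "PstarMD star"
  obtains B :: "'d::idom set" where "finite B" "\<not> B \<subseteq> {0}" "\<And>b. b \<in> B \<Longrightarrow> to_fract b * x \<in> base_ring"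
    "\<And>M. M \<in> QMax (star_f star) \<Longrightarrow> x \<in> localization M \<Longrightarrow> \<not> B \<subseteq> M"
proof -
  let ?F = "dscale.span {1, x}"
  have F: "?F \<in> fg_submods" by (rule fg_submodsI[of _ 1]) (auto intro: dscale.span_base)
  obtain G where G: "G \<in> fg_submods" "G \<subseteq> mod_prod ?F (mod_inv ?F)" "1 \<in> star G"
    using PstarMD_one[OF assms F] by (auto simp: star_f_iff)
  obtain A where A: "finite A" "G = dscale.span A" "A \<subseteq> G" using G(1) by (rule fg_submodsE)
  obtain B' where B': "finite B'" "B' \<subseteq> mod_inv ?F" "A \<subseteq> mod_prod ?F (dscale.span B')"
    using mod_prod_finite_subset[OF A(1), of ?F "mod_inv ?F"] A(3) G(2) by blast
  have inv: "b \<in> base_ring" "b * x \<in> base_ring" if "b \<in> mod_inv ?F" for b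
  proof -
    have "b * 1 \<in> base_ring" "b * x \<in> base_ring"
      using that dscale.span_base[of _ "{1, x}"] unfolding mod_inv_def colon_def by blast+
    then show "b \<in> base_ring" "b * x \<in> base_ring" by simp_all
  qed
  \<comment> \<open>As 1 lies in \<open>?F\<close>, the inverse of \<open>?F\<close> is contained in
    \<open>D\<close>, so \<open>B'\<close> comes from ring elements.\<close>
  then have "B' \<subseteq> range to_fract" using B'(2) by (auto simp: base_ring_def)
  then obtain B where B: "finite B" "B' = to_fract ` B"
    using finite_subset_image[OF B'(1)] by metis
  \<comment> \<open>The assumptions place all products of the generators 1 and \<open>x\<close> with
    elements of \<open>B\<close> in \<open>I\<close>. The case \<open>I = {0}\<close> contradicts
    \<open>G\<close> being nonzero; the case \<open>I = M\<close> contradicts 1 being in the closure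
    of \<open>G\<close>.\<close>
  have GI: "G \<subseteq> to_fract ` I"
    if I: "dideal I" "B \<subseteq> I" and xB: "\<And>b. b \<in> B \<Longrightarrow> to_fract b * x \<in> to_fract ` I" for I
  proof -
    have sI: "dscale.subspace (to_fract ` I)" using I(1) by (simp add: subspace_to_fract_image)
    have "u * v \<in> to_fract ` I" if "u \<in> {1, x}" "v \<in> B'" for u v
      using that B(2) I(2) xB by (auto simp: mult.commute)
    then have "mod_prod ?F (dscale.span B') \<subseteq> to_fract ` I"
      by (intro mod_prod_subset[OF sI]) (rule span_mult_subset[OF sI])
    then show ?thesis
      unfolding A(2) using B'(3) by (intro dscale.span_minimal sI) blast
  qed
  show thesis
  proof (rule that[OF B(1)])
    show "to_fract b * x \<in> base_ring" if "b \<in> B" for b using that inv(2) B'(2) B(2) by blast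
    show "\<not> B \<subseteq> {0}"
    proof
      assume B0: "B \<subseteq> {0}"
      have "dideal {0 :: 'd}" by (simp add: dideal_iff)
      then have "G \<subseteq> to_fract ` {0}" using B0 by (rule GI) (use B0 in auto)
      then show False using submods_nonzero[OF fg_submods_submods[OF G(1)]] by auto
    qed
    show "\<not> B \<subseteq> M" if M: "M \<in> QMax (star_f star)" and xM: "x \<in> localization M" for M
    proof
      assume BM: "B \<subseteq> M"
      have MS: "M \<in> Spec" using M QMax_subset_Spec[OF star_f_semistar[OF assms(1)]] by blast
      then have dM: "dideal M" by (simp add: Spec_def)
      obtain s a where s: "s \<notin> M" "to_fract s * x = to_fract a"
        using xM unfolding localization_iff[OF MS] base_ring_def by blast
      \<comment> \<open>If \<open>s * x = a\<close> with \<open>s\<close> outside \<open>M\<close>,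
        then \<open>s * (b * x) = a * b\<close> lies in \<open>M\<close>, and primeness of
        \<open>M\<close> cancels \<open>s\<close>.\<close>
      have "to_fract b * x \<in> to_fract ` M" if b: "b \<in> B" for b
      proof -
        obtain c where c: "to_fract b * x = to_fract c"
          using b inv(2) B'(2) B(2) unfolding base_ring_def by blast
        have "to_fract (s * c) = to_fract b * (to_fract s * x)"
          by (simp add: c[symmetric] mult.left_commute)
        also have "\<dots> = to_fract (a * b)" unfolding s(2) by (simp add: mult.commute)
        finally have "s * c = a * b" by (simp only: to_fract_eq_iff)
        also have "\<dots> \<in> M" using dM BM b unfolding dideal_iff by blast
        finally have "c \<in> M" using s(1) SpecD(3)[OF MS] by blast
        then show ?thesis using c by blast
      qed
      with dM BM have "G \<subseteq> to_fract ` M" by (rule GI)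
      then have "1 \<in> star_f star (to_fract ` M)" using G(1,3) unfolding star_f_iff by blast
      moreover have "1 \<notin> star_f star (to_fract ` M)" using M by (rule QMax_one_notin)
      ultimately show False by blast
    qed
  qed
qed

text \<open>The conductor elements \<open>B\<close> lie in no \<open>M\<close> of
  \<open>nabla\<close>, so the \<nabla>-closure of their span contains 1. That span being finitely
  generated, this survives the passage to \<open>star_f\<close>. Hence no quasi-maximal ideal of the
  finite-type operation contains \<open>B\<close>, and at each of them some \<open>b\<close> in
  \<open>B\<close> is a denominator for \<open>x\<close>.\<close>

lemma Theta_subset_star_tilde:
  assumes "semistar star" "PstarMD star"
  shows "Theta (star_f star) P \<subseteq> star_tilde (spectral (nabla (star_f star) P)) base_ring"
proof
  fix x assume x: "x \<in> Theta (star_f star) P"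
  let ?N = "nabla (star_f star) P"
  note NS = nabla_subset_Spec[OF star_f_semistar[OF assms(1)], of P]
  note QS = QMax_subset_Spec[OF star_f_semistar[OF spectral_semistar[OF NS]]]
  obtain B where B: "finite B" "\<not> B \<subseteq> {0}" "\<And>b. b \<in> B \<Longrightarrow> to_fract b * x \<in> base_ring"
    "\<And>M. M \<in> QMax (star_f star) \<Longrightarrow> x \<in> localization M \<Longrightarrow> \<not> B \<subseteq> M"
    using PstarMD_finite_conductor[OF assms, of x] by metis
  let ?J = "dscale.span (to_fract ` B)"
  obtain b where "b \<in> B" "b \<noteq> 0" using B(2) by blast
  then have J: "?J \<in> fg_submods"
    using B(1) by (intro fg_submodsI[of _ "to_fract b"]) (auto intro: dscale.span_base)
  have "1 \<in> spectral ?N ?J"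
    unfolding spectral_iff[OF NS fg_submods_submods[OF J]]
  proof
    fix M assume M: "M \<in> ?N"
    then have "\<not> B \<subseteq> M" using x by (intro B(4)) (auto simp: nabla_def Theta_def)
    then obtain b where "b \<in> B" "b \<notin> M" by blast
    then show "\<exists>s. s \<notin> M \<and> to_fract s * 1 \<in> ?J" by (auto intro: dscale.span_base)
  qed
  then have one: "1 \<in> star_f (spectral ?N) (to_fract ` I)" if "?J \<subseteq> to_fract ` I" for I
    using J that unfolding star_f_iff by blast
  show "x \<in> star_tilde (spectral ?N) base_ring"
    unfolding star_tilde_def spectral_iff[OF QS fg_submods_submods[OF base_ring_fg]]
  proof
    fix M assume M: "M \<in> QMax (star_f (spectral ?N))"
    then have "1 \<notin> star_f (spectral ?N) (to_fract ` M)" by (rule QMax_one_notin)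
    then have "\<not> ?J \<subseteq> to_fract ` M" using one by blast
    moreover have "dscale.subspace (to_fract ` M)"
      using QMax_dideal[OF M] by (simp add: subspace_to_fract_image)
    ultimately have "\<not> to_fract ` B \<subseteq> to_fract ` M"
      using dscale.span_minimal[of "to_fract ` B" "to_fract ` M"] by metis
    then have "\<not> B \<subseteq> M" by blast
    then show "\<exists>s. s \<notin> M \<and> to_fract s * x \<in> base_ring" using B(3) by blast
  qed
qed

text \<open>The closure of \<open>P\<close> under \<open>spectral Y\<close> omits 1, already because
  of the component at \<open>P\<close>. So \<open>P\<close> lies below some quasi-maximal
  \<open>M\<close>, and denominators outside \<open>M\<close> are also outside
  \<open>P\<close>.\<close>

lemma star_tilde_spectral_subset_localization:
  assumes "Y \<subseteq> Spec" "P \<in> Y" "P \<noteq> {0}"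
  shows "star_tilde (spectral Y) base_ring \<subseteq> localization P"
proof -
  have PS: "P \<in> Spec" using assms by blast
  then have dP: "dideal P" by (simp add: Spec_def)
  note P = dideal_submods[OF dP assms(3)]
  note QS = QMax_subset_Spec[OF star_f_semistar[OF spectral_semistar[OF assms(1)]]]
  have "1 \<notin> spectral Y (to_fract ` P)"
    using assms(2) unfolding spectral_iff[OF assms(1) P] by auto
  moreover have "star_f (spectral Y) (to_fract ` P) \<subseteq> spectral Y (to_fract ` P)"
    using semistar_mono[OF spectral_semistar[OF assms(1)] _ P] fg_submods_submods
    unfolding star_f_def by blast
  ultimately have "1 \<notin> star_f (spectral Y) (to_fract ` P)" by blast
  then obtain M where M: "M \<in> QMax (star_f (spectral Y))" "P \<subseteq> M"
    using QMax_exists[OF spectral_semistar[OF assms(1)] dP assms(3)] by metis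
  show ?thesis
  proof
    fix x assume "x \<in> star_tilde (spectral Y) base_ring"
    then obtain s where "s \<notin> M" "to_fract s * x \<in> base_ring"
      unfolding star_tilde_def spectral_iff[OF QS fg_submods_submods[OF base_ring_fg]]
      using M(1) by blast
    then show "x \<in> localization P" unfolding localization_iff[OF PS] using M(2) by blast
  qed
qed

text \<open>In a P\<open>\<star>\<close>MD every finitely generated \<open>H\<close> satisfies \<open>H D\<^sub>P = h D\<^sub>P\<close> for some \<open>h\<close> in \<open>H\<close>, so that
  \<open>x H \<subseteq> H D\<^sub>P\<close> forces \<open>x\<close> into \<open>D\<^sub>P\<close>.\<close>

lemma star_a_spectral_subset_localization:
  assumes "semistar star" "PstarMD star" "P \<in> QSpec (star_f star)"
    and "Y \<subseteq> Spec" "P \<in> Y"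
  shows "star_a (spectral Y) base_ring \<subseteq> localization P"
proof
  have PS: "P \<in> Spec" using assms(3) by (simp add: QSpec_def)
  fix x assume "x \<in> star_a (spectral Y) base_ring"
  then obtain F H where F: "F \<in> fg_submods" "F \<subseteq> base_ring" and H: "H \<in> fg_submods"
    and x: "x \<in> colon (spectral Y (mod_prod F H)) (spectral Y H)"
    unfolding star_a_def star_a_fg_def by blast
  note Hs = fg_submods_submods[OF H]
  have "u * v \<in> H" if "u \<in> F" "v \<in> H" for u v
    using that F(2) to_fract_mult_closed[OF Hs] unfolding base_ring_def by blast
  then have FH: "mod_prod F H \<subseteq> H" using submods_subspace[OF Hs] by (intro mod_prod_subset)
  obtain h w d where h: "h \<in> H" and w: "w \<in> mod_inv H" and d: "d \<notin> P" "h * w = to_fract d"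
    using assms(1,2) H assms(3) by (rule PstarMD_invertible)
  have "h \<in> spectral Y H" using spectral_extensive[OF assms(4) Hs] h by blast
  then have "x * h \<in> spectral Y (mod_prod F H)" using x by (simp add: colon_def)
  then obtain s where s: "s \<notin> P" "to_fract s * (x * h) \<in> mod_prod F H"
    using assms(5) F(1) H
    unfolding spectral_iff[OF assms(4) mod_prod_submods[OF fg_submods_submods[OF F(1)] Hs]] by blast
  \<comment> \<open>\<open>w\<close> multiplies \<open>H\<close> into \<open>D\<close> and
    \<open>h * w = d\<close>, so \<open>s * d\<close> is a denominator for \<open>x\<close> outside
    \<open>P\<close>.\<close>
  then have "w * (to_fract s * (x * h)) \<in> base_ring"
    using w FH by (auto simp: mod_inv_def colon_def)
  moreover have "w * (to_fract s * (x * h)) = to_fract (s * d) * x"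
    by (simp add: d(2)[symmetric] ac_simps)
  ultimately show "x \<in> localization P"
    unfolding localization_iff[OF PS] using SpecD(3)[OF PS s(1) d(1)] by metis
qed

text \<open>This is the term of the union with \<open>F\<close> and \<open>H\<close> both equal to
  \<open>D\<close>.\<close>

lemma star_base_ring_subset_star_a:
  assumes "semistar star"
  shows "star base_ring \<subseteq> star_a star base_ring"
proof
  fix x assume x: "x \<in> star (base_ring :: 'a fract set)"
  note D = base_ring_fg fg_submods_submods[OF base_ring_fg]
  have sD: "star base_ring \<in> submods" using assms D(2) by (rule semistar_submods)
  have "base_ring \<subseteq> mod_prod base_ring (base_ring :: 'a fract set)"
    using mod_prodI[OF _ one_in_base_ring] by fastforce
  then have DD: "star base_ring \<subseteq> star (mod_prod base_ring (base_ring :: 'a fract set))"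
    by (rule semistar_mono[OF assms D(2) mod_prod_submods[OF D(2) D(2)]])
  have "x * y \<in> star base_ring" if "y \<in> base_ring" for y
    using that to_fract_mult_closed[OF sD x] by (auto simp: base_ring_def mult.commute)
  with DD have "x \<in> colon (star (mod_prod base_ring base_ring)) base_ring"
    by (auto simp: colon_def)
  then have "x \<in> colon (star (mod_prod base_ring base_ring)) (star base_ring)"
    using colon_star[OF assms mod_prod_submods[OF D(2) D(2)] D(2)] by blast
  then show "x \<in> star_a star base_ring"
    unfolding star_a_def star_a_fg_def using D(1) by blast
qed

theorem corollary3p2:
  fixes star :: "'d::idom fract set \<Rightarrow> 'd fract set" and P :: "'d set"
  assumes "semistar star"
    and "PstarMD star"
    and "P \<in> QSpec (star_f star)"
  shows "(sharp (star_f star) P \<longleftrightarrow>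
            op_less (star_tilde (spectral (Delta (star_f star) P)))
                    (star_tilde (spectral (nabla (star_f star) P)))) \<and>
         (sharp (star_f star) P \<longleftrightarrow>
            op_less (star_f (spectral (Delta (star_f star) P)))
                    (star_f (spectral (nabla (star_f star) P)))) \<and>
         (sharp (star_f star) P \<longleftrightarrow>
            op_less (star_a (spectral (Delta (star_f star) P)))
                    (star_a (spectral (nabla (star_f star) P))))"
proof -
  let ?N = "nabla (star_f star) P" and ?D = "Delta (star_f star) P"
  have P: "P \<in> Spec" "P \<noteq> {0}" using assms(3) by (auto simp: QSpec_def quasi_ideal_def)
  have N: "?N \<subseteq> Spec" by (rule nabla_subset_Spec[OF star_f_semistar[OF assms(1)]])
  with P(1) have D: "?D \<subseteq> Spec" by (simp add: Delta_def)
  have PD: "P \<in> ?D" by (simp add: Delta_def)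
  note ssN = spectral_semistar[OF N] and ssD = spectral_semistar[OF D]
  have le: "op_le (spectral ?D) (spectral ?N)"
    unfolding op_le_def Delta_def using spectral_antimono[of ?N "?N \<union> {P}"] by blast
  note base = fg_submods_submods[OF base_ring_fg]
  show ?thesis
  proof (cases "sharp (star_f star) P")
    case True
    then obtain x where x: "x \<in> Theta (star_f star) P" "x \<notin> localization P"
      unfolding sharp_def by blast
    \<comment> \<open>The same \<open>x\<close> separates all three pairs of operations, each
      evaluated at \<open>base_ring\<close>.\<close>
    have xN: "x \<in> spectral ?N base_ring" using x(1) Theta_iff[OF N] by blast
    have xD: "x \<notin> spectral ?D base_ring"
      using x(2) PD unfolding spectral_iff[OF D base] localization_iff[OF P(1)] by blast
    have "op_less (star_tilde (spectral ?D)) (star_tilde (spectral ?N))"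
      unfolding op_less_def
      using star_tilde_op_le[OF ssD ssN le] base x
        Theta_subset_star_tilde[OF assms(1,2), of P]
        star_tilde_spectral_subset_localization[OF D PD P(2)] by blast
    moreover have "op_less (star_f (spectral ?D)) (star_f (spectral ?N))"
      unfolding op_less_def
      using star_f_op_le[OF le] base xN xD star_f_fg[OF ssD base_ring_fg]
        star_f_fg[OF ssN base_ring_fg] by metis
    moreover have "op_less (star_a (spectral ?D)) (star_a (spectral ?N))"
      unfolding op_less_def
      using star_a_op_le[OF ssD ssN le] base x(2) xN star_base_ring_subset_star_a[OF ssN]
        star_a_spectral_subset_localization[OF assms D PD] by blast
    ultimately show ?thesis using True by blast
  next
    case False
    note eq = spectral_Delta_eq_nabla[OF assms False]
    have "star_f (spectral ?D) = star_f (spectral ?N)" using eq by (rule star_f_cong)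
    moreover have "star_a (spectral ?D) = star_a (spectral ?N)" using eq by (rule star_a_cong)
    \<comment> \<open>\<open>star_tilde\<close> is defined through \<open>star_f\<close> alone, so
      equality of the finite-type operations settles it as well.\<close>
    ultimately show ?thesis using False by (simp add: op_less_def star_tilde_def)
  qed
qed

end
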